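(* Let $c>I>0$, $k>L>0$, $X/2>I$, and let $\{\pi_q\}_{q\in[0,1]}$ be a continuous nested family of information structures. Let $U_J(q)$ be the stakeholder's equilibrium ex-ante expected payoff in Regime J with private signal $\pi_q$, and $U_C$ the stakeholder's equilibrium ex-ante expected payoff in Regime C. Then there exists a threshold $q^{\dagger}\in(0,1)$ such that, for $q\in[0,1]$, the stakeholder prefers Regime J over Regime C (that is, $U_J(q)>U_C$) if and only if $q>q^{\dagger}$.
   Context: Model. A state $\theta\in\{G,B\}$ has $\Pr(\theta=G)=\Pr(\theta=B)=1/2$. A project costs $I$ and returns $X$ if $\theta=G$ and $0$ if $\theta=B$. An auditor chooses effort $\beta\in[0,1]$ at cost $\frac12 k\beta^2$; a report $r\in\{g,b\}$ has $\Pr(r=g\mid G)=1$, $\Pr(r=g\mid B)=1-\beta$. If $r=b$ the project is not undertaken and there is no verification. If $r=g$, verification at level $a\in[0,1)$ costs the stakeholder $\frac12ca^2$ and identifies the state with probability $a$; if it reveals $B$ the auditor loses $L$ and the project is not undertaken; otherwise the project is undertaken and the auditor loses nothing. Gross of verification cost, the stakeholder gets $X-I$ if the project is undertaken in state $G$, $-I$ if undertaken in state $B$, $0$ otherwise. Put $i=I/c$ and $l=L/k$. Continuous nested family $\{\pi_q\}_{q\in[0,1]}$: each $\pi_q$ is a signal $s$ about $\theta$ with values in a finite set $\{\omega_t\}$, with conditional probabilities $\Pr_q(s=\omega_t\mid\theta)$ varying continuously in $q$; whenever $q'>q$, $\pi_{q'}$ strictly Blackwell dominates $\pi_q$; $\pi_0$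 is uninformative and $\pi_1$ is perfectly informative. The signal $s$ is independent of $r$ conditional on $\theta$. Regime J: the auditor chooses $\beta$ (unobserved); then the stakeholder observes $r$ and $s\sim\pi_q$ and, if $r=g$, chooses $a(s)$. In the unique equilibrium, $a(\omega_t)=i\Pr(\theta=B\mid r=g,s=\omega_t)=i\frac{(1-\beta_J)\Pr_q(\omega_t\mid B)}{(1-\beta_J)\Pr_q(\omega_t\mid B)+\Pr_q(\omega_t\mid G)}$, and, with $\bar a=\sum_t\Pr_q(\omega_t\mid B)a(\omega_t)$, the effort $\beta_J=\beta_J(q)$ is the unique $\beta_J\in[0,1)$ satisfying $\beta_J=\frac l2\bar a$. (Realizations having probability $0$ in both states are disregarded.) The ex-ante payoff is $$U_J(q)=\tfrac12(X-I)-\tfrac I2(1-\beta_J)\sum_t\Pr\nolimits_q(\omega_t\mid B)(1-a(\omega_t))-\tfrac c2\sum_t\Pr(r=g,s=\omega_t)\,a(\omega_t)^2,$$ where $\Pr(r=g,s=\omega_t)=\frac12\Pr_q(\omega_t\mid G)+\frac12(1-\beta_J)\Pr_q(\omega_t\mid B)$. Regime C: the stakeholder first commits to $a\in[0,1)$ (carried out when $r=g$), the auditor observes $a$ and best-responds with $\beta(a)=\frac l2a$; there is no signal. $U_C$ is the maximum over $a\in[0,1)$, attained at a unique $a_C$, of $$\tfrac12(X-I)-\tfrac12(1-\beta(a))(1-a)I-\Big(\tfrac12(1-\beta(a))+\tfrac12\Big)\tfrac{ca^2}{2}.$$ *)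

theory Defs
  imports "HOL-Probability.Probability_Mass_Function"
begin

section \<open>Information structures\<close>

datatype state = Good | Bad

lemma UNIV_state: "UNIV = {Good, Bad}"
  using state.exhaust by auto

instance state :: finite
  by standard (simp add: UNIV_state)

lemma sum_state: "(\<Sum>\<theta>\<in>UNIV. f \<theta>) = f Good + (f Bad :: real)"
  by (simp add: UNIV_state)

text \<open>A signal about the state: its conditional distribution given each state.\<close>

type_synonym 'w info = "state \<Rightarrow> 'w pmf"

definition blackwell_dominates :: "'v info \<Rightarrow> 'w info \<Rightarrow> bool" where
  "blackwell_dominates \<pi>' \<pi> \<longleftrightarrow> (\<exists>K :: 'v \<Rightarrow> 'w pmf. \<forall>\<theta>. \<pi> \<theta> = bind_pmf (\<pi>' \<theta>) K)"

definition strictly_blackwell_dominates :: "'v info \<Rightarrow> 'w info \<Rightarrow> bool" where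
  "strictly_blackwell_dominates \<pi>' \<pi> \<longleftrightarrow>
     blackwell_dominates \<pi>' \<pi> \<and> \<not> blackwell_dominates \<pi> \<pi>'"

definition uninformative :: "'w info \<Rightarrow> bool" where
  "uninformative \<pi> \<longleftrightarrow> \<pi> Good = \<pi> Bad"

definition perfectly_informative :: "'w info \<Rightarrow> bool" where
  "perfectly_informative \<pi> \<longleftrightarrow> set_pmf (\<pi> Good) \<inter> set_pmf (\<pi> Bad) = {}"

definition continuous_nested_family :: "(real \<Rightarrow> 'w::finite info) \<Rightarrow> bool" where
  "continuous_nested_family \<pi> \<longleftrightarrow>
     (\<forall>\<theta> \<omega>. continuous_on {0..1} (\<lambda>q. pmf (\<pi> q \<theta>) \<omega>)) \<and>
     (\<forall>q\<in>{0..1}. \<forall>q'\<in>{0..1}. q < q' \<longrightarrow> strictly_blackwell_dominates (\<pi> q') (\<pi> q)) \<and>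
     uninformative (\<pi> 0) \<and> perfectly_informative (\<pi> 1)"


section \<open>Probabilities and payoffs\<close>

text \<open>Throughout, \<open>\<beta>\<close> is the auditor's effort and \<open>a\<close> the verification level.
  \<open>prob_g \<beta> \<theta>\<close> is Pr(r = g | \<open>\<theta>\<close>).\<close>

definition prob_g :: "real \<Rightarrow> state \<Rightarrow> real" where
  "prob_g \<beta> \<theta> = (case \<theta> of Good \<Rightarrow> 1 | Bad \<Rightarrow> 1 - \<beta>)"

text \<open>Stakeholder's expected payoff, net of the verification cost, in state \<open>\<theta>\<close> after
  report g under verification level \<open>a\<close>; in the bad state the project is undertaken exactly
  when verification fails. After report b the payoff is 0.\<close>

definition stake_payoff_g :: "real \<Rightarrow> real \<Rightarrow> real \<Rightarrow> state \<Rightarrow> real \<Rightarrow> real" where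
  "stake_payoff_g c I X \<theta> a =
     (case \<theta> of Good \<Rightarrow> X - I | Bad \<Rightarrow> (1 - a) * (- I)) - c / 2 * a\<^sup>2"


section \<open>Private signal, no commitment (Regime J)\<close>

text \<open>Pr(\<open>\<theta>\<close>, r = g, s = \<open>\<omega>\<close>), using that r and s are independent given \<open>\<theta>\<close>.\<close>

definition joint_g :: "'w info \<Rightarrow> real \<Rightarrow> state \<Rightarrow> 'w \<Rightarrow> real" where
  "joint_g \<pi> \<beta> \<theta> \<omega> = 1 / 2 * prob_g \<beta> \<theta> * pmf (\<pi> \<theta>) \<omega>"

definition prob_g_signal :: "'w info \<Rightarrow> real \<Rightarrow> 'w \<Rightarrow> real" where
  "prob_g_signal \<pi> \<beta> \<omega> = (\<Sum>\<theta>\<in>UNIV. joint_g \<pi> \<beta> \<theta> \<omega>)"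

definition posterior :: "'w info \<Rightarrow> real \<Rightarrow> 'w \<Rightarrow> state \<Rightarrow> real" where
  "posterior \<pi> \<beta> \<omega> \<theta> = joint_g \<pi> \<beta> \<theta> \<omega> / prob_g_signal \<pi> \<beta> \<omega>"

definition stake_interim_J ::
    "real \<Rightarrow> real \<Rightarrow> real \<Rightarrow> 'w info \<Rightarrow> real \<Rightarrow> 'w \<Rightarrow> real \<Rightarrow> real" where
  "stake_interim_J c I X \<pi> \<beta> \<omega> a =
     (\<Sum>\<theta>\<in>UNIV. posterior \<pi> \<beta> \<omega> \<theta> * stake_payoff_g c I X \<theta> a)"

definition stake_payoff_J ::
    "real \<Rightarrow> real \<Rightarrow> real \<Rightarrow> 'w::finite info \<Rightarrow> real \<Rightarrow> ('w \<Rightarrow> real) \<Rightarrow> real" where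
  "stake_payoff_J c I X \<pi> \<beta> a =
     (\<Sum>\<omega>\<in>UNIV. \<Sum>\<theta>\<in>UNIV. joint_g \<pi> \<beta> \<theta> \<omega> * stake_payoff_g c I X \<theta> (a \<omega>))"

definition auditor_payoff_J ::
    "real \<Rightarrow> real \<Rightarrow> 'w::finite info \<Rightarrow> ('w \<Rightarrow> real) \<Rightarrow> real \<Rightarrow> real" where
  "auditor_payoff_J k L \<pi> a \<beta> =
     - (\<Sum>\<omega>\<in>UNIV. joint_g \<pi> \<beta> Bad \<omega> * a \<omega>) * L - k / 2 * \<beta>\<^sup>2"

text \<open>Effort is a best response to the verification plan, and the plan is optimal under the
  Bayesian posterior after every signal that can accompany report g. A best-responding
  auditor chooses \<open>\<beta> < 1\<close> when \<open>L < k\<close>, so the remaining signals have probability 0 in both states and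
  affect neither player's payoff.\<close>

definition equilibrium_J ::
    "real \<Rightarrow> real \<Rightarrow> real \<Rightarrow> real \<Rightarrow> real \<Rightarrow> 'w::finite info \<Rightarrow> real \<Rightarrow> ('w \<Rightarrow> real) \<Rightarrow> bool" where
  "equilibrium_J c I k L X \<pi> \<beta> a \<longleftrightarrow>
     (\<forall>\<omega>. a \<omega> \<in> {0..<1}) \<and>
     is_arg_max (auditor_payoff_J k L \<pi> a) (\<lambda>b. b \<in> {0..1}) \<beta> \<and>
     (\<forall>\<omega>. prob_g_signal \<pi> \<beta> \<omega> > 0 \<longrightarrow>
        is_arg_max (stake_interim_J c I X \<pi> \<beta> \<omega>) (\<lambda>x. x \<in> {0..<1}) (a \<omega>))"

definition U_J :: "real \<Rightarrow> real \<Rightarrow> real \<Rightarrow> real \<Rightarrow> real \<Rightarrow> 'w::finite info \<Rightarrow> real" where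
  "U_J c I k L X \<pi> =
     (THE u. \<exists>\<beta> a. equilibrium_J c I k L X \<pi> \<beta> a \<and> u = stake_payoff_J c I X \<pi> \<beta> a)"


section \<open>Commitment, no signal (Regime C)\<close>

definition stake_payoff_C :: "real \<Rightarrow> real \<Rightarrow> real \<Rightarrow> real \<Rightarrow> real \<Rightarrow> real" where
  "stake_payoff_C c I X \<beta> a =
     (\<Sum>\<theta>\<in>UNIV. 1 / 2 * prob_g \<beta> \<theta> * stake_payoff_g c I X \<theta> a)"

definition auditor_payoff_C :: "real \<Rightarrow> real \<Rightarrow> real \<Rightarrow> real \<Rightarrow> real" where
  "auditor_payoff_C k L a \<beta> = - (1 / 2 * prob_g \<beta> Bad * a) * L - k / 2 * \<beta>\<^sup>2"

text \<open>Subgame-perfect equilibrium: the auditor's strategy \<open>b\<close> responds optimally to every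
  admissible commitment, and \<open>a\<close> is an optimal commitment given \<open>b\<close>.\<close>

definition equilibrium_C ::
    "real \<Rightarrow> real \<Rightarrow> real \<Rightarrow> real \<Rightarrow> real \<Rightarrow> real \<Rightarrow> (real \<Rightarrow> real) \<Rightarrow> bool" where
  "equilibrium_C c I k L X a b \<longleftrightarrow>
     (\<forall>x\<in>{0..<1}. is_arg_max (auditor_payoff_C k L x) (\<lambda>\<beta>. \<beta> \<in> {0..1}) (b x)) \<and>
     is_arg_max (\<lambda>x. stake_payoff_C c I X (b x) x) (\<lambda>x. x \<in> {0..<1}) a"

definition U_C :: "real \<Rightarrow> real \<Rightarrow> real \<Rightarrow> real \<Rightarrow> real \<Rightarrow> real" where
  "U_C c I k L X =
     (THE u. \<exists>a b. equilibrium_C c I k L X a b \<and> u = stake_payoff_C c I X (b a) a)"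


section \<open>Agreement with the closed forms\<close>

lemma sum_pmf_UNIV: "(\<Sum>\<omega>\<in>UNIV. pmf p \<omega>) = 1" for p :: "'w::finite pmf"
  by (rule sum_pmf_eq_1) auto

lemma prob_g_signal_eq:
  "prob_g_signal \<pi> \<beta> \<omega> = 1 / 2 * pmf (\<pi> Good) \<omega> + 1 / 2 * (1 - \<beta>) * pmf (\<pi> Bad) \<omega>"
  by (simp add: prob_g_signal_def joint_g_def prob_g_def sum_state)

lemma posterior_Bad:
  "posterior \<pi> \<beta> \<omega> Bad =
     (1 - \<beta>) * pmf (\<pi> Bad) \<omega> / ((1 - \<beta>) * pmf (\<pi> Bad) \<omega> + pmf (\<pi> Good) \<omega>)"
proof -
  have "prob_g_signal \<pi> \<beta> \<omega> = 1 / 2 * ((1 - \<beta>) * pmf (\<pi> Bad) \<omega> + pmf (\<pi> Good) \<omega>)"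
    by (simp add: prob_g_signal_eq field_simps)
  moreover have "joint_g \<pi> \<beta> Bad \<omega> = 1 / 2 * ((1 - \<beta>) * pmf (\<pi> Bad) \<omega>)"
    by (simp add: joint_g_def prob_g_def)
  ultimately show ?thesis
    unfolding posterior_def by (simp only: mult_divide_mult_cancel_left_if) simp
qed

lemma stake_payoff_J_eq:
  "stake_payoff_J c I X \<pi> \<beta> a =
     1 / 2 * (X - I) - I / 2 * (1 - \<beta>) * (\<Sum>\<omega>\<in>UNIV. pmf (\<pi> Bad) \<omega> * (1 - a \<omega>))
     - c / 2 * (\<Sum>\<omega>\<in>UNIV. prob_g_signal \<pi> \<beta> \<omega> * (a \<omega>)\<^sup>2)"
proof -
  have "stake_payoff_J c I X \<pi> \<beta> a =
      (\<Sum>\<omega>\<in>UNIV. 1 / 2 * (X - I) * pmf (\<pi> Good) \<omega>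
         - I / 2 * (1 - \<beta>) * (pmf (\<pi> Bad) \<omega> * (1 - a \<omega>))
         - c / 2 * (prob_g_signal \<pi> \<beta> \<omega> * (a \<omega>)\<^sup>2))"
    unfolding stake_payoff_J_def
    by (rule sum.cong)
      (simp_all add: sum_state prob_g_signal_def joint_g_def prob_g_def stake_payoff_g_def
        field_simps)
  also have "\<dots> = 1 / 2 * (X - I) * (\<Sum>\<omega>\<in>UNIV. pmf (\<pi> Good) \<omega>)
      - I / 2 * (1 - \<beta>) * (\<Sum>\<omega>\<in>UNIV. pmf (\<pi> Bad) \<omega> * (1 - a \<omega>))
      - c / 2 * (\<Sum>\<omega>\<in>UNIV. prob_g_signal \<pi> \<beta> \<omega> * (a \<omega>)\<^sup>2)"
    by (simp only: sum_subtractf sum_distrib_left)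
  finally show ?thesis
    by (simp add: sum_pmf_UNIV)
qed

lemma stake_payoff_C_eq:
  "stake_payoff_C c I X \<beta> a =
     1 / 2 * (X - I) - 1 / 2 * (1 - \<beta>) * (1 - a) * I
     - (1 / 2 * (1 - \<beta>) + 1 / 2) * (c * a\<^sup>2 / 2)"
  by (simp add: stake_payoff_C_def sum_state prob_g_def stake_payoff_g_def field_simps)

lemma is_arg_max_quadratic:
  fixes f :: "real \<Rightarrow> real"
  assumes f: "\<And>x. f x = d - m * (x - z)\<^sup>2" and "m > 0" and z: "P z"
  shows "is_arg_max f P x \<longleftrightarrow> x = z"
proof
  assume x: "is_arg_max f P x"
  have "f z \<le> f x"
    using x z unfolding is_arg_max_def by force
  then have "m * (x - z)\<^sup>2 \<le> 0"
    by (simp add: f)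
  then have "(x - z)\<^sup>2 \<le> 0"
    using \<open>m > 0\<close> by (simp add: mult_le_0_iff)
  then show "x = z" by simp
next
  assume "x = z"
  moreover have "f y \<le> f z" for y
    using \<open>m > 0\<close> by (simp add: f)
  ultimately show "is_arg_max f P x"
    using z unfolding is_arg_max_def by (meson not_less)
qed

lemma auditor_best_response_C:
  assumes "k > L" "L > 0" "x \<in> {0..<1}"
  shows "is_arg_max (auditor_payoff_C k L x) (\<lambda>\<beta>. \<beta> \<in> {0..1}) \<beta> \<longleftrightarrow> \<beta> = (L / k) / 2 * x"
proof (rule is_arg_max_quadratic)
  show "auditor_payoff_C k L x b =
      (k / 2 * ((L / k) / 2 * x)\<^sup>2 - L * x / 2) - k / 2 * (b - (L / k) / 2 * x)\<^sup>2" for b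
    using assms by (simp add: auditor_payoff_C_def prob_g_def field_simps power2_eq_square)
  show "k / 2 > 0" using assms by simp
  have "L * x \<le> k * 1" using assms by (intro mult_mono) auto
  then show "(L / k) / 2 * x \<in> {0..1}"
    using assms by (simp add: field_simps)
qed

lemma auditor_best_response_J:
  fixes \<pi> :: "'w::finite info"
  assumes "k > L" "L > 0" and a: "\<And>\<omega>. a \<omega> \<in> {0..<1}"
  shows "is_arg_max (auditor_payoff_J k L \<pi> a) (\<lambda>\<beta>. \<beta> \<in> {0..1}) \<beta> \<longleftrightarrow>
     \<beta> = (L / k) / 2 * (\<Sum>\<omega>\<in>UNIV. pmf (\<pi> Bad) \<omega> * a \<omega>)"
proof -
  define A where "A = (\<Sum>\<omega>\<in>UNIV. pmf (\<pi> Bad) \<omega> * a \<omega>)"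
  have A0: "A \<ge> 0" unfolding A_def using a by (intro sum_nonneg) auto
  have "A \<le> (\<Sum>\<omega>\<in>UNIV. pmf (\<pi> Bad) \<omega> * 1)"
    unfolding A_def using a by (intro sum_mono mult_left_mono) (auto simp: less_imp_le)
  then have A1: "A \<le> 1" by (simp add: sum_pmf_UNIV)
  have lose: "(\<Sum>\<omega>\<in>UNIV. joint_g \<pi> b Bad \<omega> * a \<omega>) = 1 / 2 * (1 - b) * A" for b
    by (simp add: A_def joint_g_def prob_g_def sum_distrib_left mult.assoc)
  have eq: "auditor_payoff_J k L \<pi> a b =
      (k / 2 * ((L / k) / 2 * A)\<^sup>2 - L * A / 2) - k / 2 * (b - (L / k) / 2 * A)\<^sup>2" for b
    unfolding auditor_payoff_J_def lose using assms by (simp add: field_simps power2_eq_square)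
  have "L * A \<le> k * 1" using assms A0 A1 by (intro mult_mono) auto
  then have "(L / k) / 2 * A \<in> {0..1}"
    using assms A0 by (simp add: field_simps)
  then show ?thesis
    unfolding A_def[symmetric] using assms by (intro is_arg_max_quadratic[OF eq]) auto
qed

lemma stake_best_response_J:
  assumes "c > I" "I > 0" "\<beta> \<le> 1" and pos: "prob_g_signal \<pi> \<beta> \<omega> > 0"
  shows "is_arg_max (stake_interim_J c I X \<pi> \<beta> \<omega>) (\<lambda>x. x \<in> {0..<1}) x \<longleftrightarrow>
     x = I / c * posterior \<pi> \<beta> \<omega> Bad"
proof -
  define p where "p = posterior \<pi> \<beta> \<omega> Bad"
  have s: "posterior \<pi> \<beta> \<omega> Good = 1 - p"
    using pos unfolding p_def posterior_def prob_g_signal_def sum_state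
    by (simp add: field_simps)
  have "joint_g \<pi> \<beta> Good \<omega> \<ge> 0" "joint_g \<pi> \<beta> Bad \<omega> \<ge> 0"
    using assms by (auto simp: joint_g_def prob_g_def)
  then have p: "0 \<le> p" "p \<le> 1"
    using pos by (auto simp: p_def posterior_def prob_g_signal_def sum_state)
  have eq: "stake_interim_J c I X \<pi> \<beta> \<omega> y =
      ((1 - p) * (X - I) - p * I + c / 2 * (I / c * p)\<^sup>2) - c / 2 * (y - I / c * p)\<^sup>2" for y
    using assms unfolding stake_interim_J_def sum_state s p_def[symmetric]
    by (simp add: stake_payoff_g_def field_simps power2_eq_square)
  have "I * p \<le> I * 1" using assms p by (intro mult_left_mono) auto
  then have "I * p < c" using assms by linarith
  then have "I / c * p \<in> {0..<1}"
    using assms p by (simp add: field_simps)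
  then show ?thesis
    unfolding p_def[symmetric] using assms by (intro is_arg_max_quadratic[OF eq]) auto
qed

theorem equilibrium_J_iff:
  assumes "c > I" "I > 0" "k > L" "L > 0"
  shows "equilibrium_J c I k L X \<pi> \<beta> a \<longleftrightarrow>
     (\<forall>\<omega>. a \<omega> \<in> {0..<1}) \<and>
     \<beta> = (L / k) / 2 * (\<Sum>\<omega>\<in>UNIV. pmf (\<pi> Bad) \<omega> * a \<omega>) \<and>
     (\<forall>\<omega>. prob_g_signal \<pi> \<beta> \<omega> > 0 \<longrightarrow> a \<omega> = I / c * posterior \<pi> \<beta> \<omega> Bad)"
proof (cases "(\<forall>\<omega>. a \<omega> \<in> {0..<1}) \<and>
    is_arg_max (auditor_payoff_J k L \<pi> a) (\<lambda>\<beta>. \<beta> \<in> {0..1}) \<beta>")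
  case True
  then have "\<beta> \<le> 1"
    by (simp add: is_arg_max_def)
  with True show ?thesis
    using auditor_best_response_J[OF assms(3,4), of a \<pi> \<beta>]
      stake_best_response_J[OF assms(1,2), of \<beta> \<pi>]
    unfolding equilibrium_J_def by blast
next
  case False
  then show ?thesis
    using auditor_best_response_J[OF assms(3,4), of a \<pi> \<beta>]
    unfolding equilibrium_J_def by blast
qed

end

theory Submission
  imports Defs
begin

text \<open>In Regime J let \<open>A\<close> be the mean verification level in the bad state. Optimality of \<open>a\<close> against
  the posterior makes the verification cost half of its benefit, so the stakeholder's payoff equals
  \<open>(X - I)/2 - I/2 (1 - l A/2) (1 - A/2)\<close>, an increasing function of \<open>A\<close> alone. Moreover \<open>A\<close> is the
  fixed point of \<open>A \<mapsto> i S\<^sub>q(l A/2)\<close>, where \<open>S\<^sub>q(\<beta>)\<close> is the mean posterior of the bad state given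
  the bad state and report g. As \<open>S\<^sub>q\<close> decreases in \<open>\<beta>\<close>, the fixed point exceeds a level \<open>A*\<close> iff
  \<open>i S\<^sub>q(l A*/2) > A*\<close>; take \<open>A*\<close> to be the level whose payoff is \<open>U\<^sub>C\<close>. For fixed \<open>\<beta>\<close>, \<open>S\<^sub>q(\<beta>)\<close> is a
  Csiszar divergence, hence increasing in the Blackwell order, and it is continuous in \<open>q\<close>.
  It remains to compare the endpoints. At \<open>q = 0\<close> Regime J yields the commitment payoff of a
  level at which the direct marginal gain from verification vanishes but deterrence still pays, so
  \<open>U\<^sub>J(0) < U\<^sub>C\<close>; at \<open>q = 1\<close> the inequality \<open>U\<^sub>J(1) > U\<^sub>C\<close> is polynomial.\<close>

section \<open>The mean posterior of the bad state\<close>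

definition mean_suspicion :: "'w::finite info \<Rightarrow> real \<Rightarrow> real" where
  "mean_suspicion \<pi> \<beta> = (\<Sum>\<omega>\<in>UNIV. pmf (\<pi> Bad) \<omega> * posterior \<pi> \<beta> \<omega> Bad)"

text \<open>At a signal of probability 0 the quotient is 0 by convention, which also satisfies the
  bounds.\<close>

lemma posterior_Bad_bounds:
  assumes "\<beta> \<le> 1"
  shows "0 \<le> posterior \<pi> \<beta> \<omega> Bad" "posterior \<pi> \<beta> \<omega> Bad \<le> 1"
  using assms by (auto simp: posterior_Bad divide_le_eq_1 add_nonneg_pos order.strict_iff_order)

lemma mean_suspicion_bounds:
  assumes "\<beta> \<le> 1"
  shows "0 \<le> mean_suspicion \<pi> \<beta>" "mean_suspicion \<pi> \<beta> \<le> 1"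
proof -
  show "0 \<le> mean_suspicion \<pi> \<beta>"
    unfolding mean_suspicion_def
    using posterior_Bad_bounds[OF assms] by (intro sum_nonneg mult_nonneg_nonneg) auto
  have "mean_suspicion \<pi> \<beta> \<le> (\<Sum>\<omega>\<in>UNIV. pmf (\<pi> Bad) \<omega> * 1)"
    unfolding mean_suspicion_def
    using posterior_Bad_bounds[OF assms] by (intro sum_mono mult_left_mono) auto
  then show "mean_suspicion \<pi> \<beta> \<le> 1"
    by (simp add: sum_pmf_UNIV)
qed

text \<open>The posterior equals 1 - g/((1 - \<beta>) b + g). More effort shrinks the denominator,
  which stays positive wherever the weight b is positive.\<close>

lemma mean_suspicion_antimono:
  assumes "\<beta> \<le> \<beta>'" "\<beta>' < 1"
  shows "mean_suspicion \<pi> \<beta>' \<le> mean_suspicion \<pi> \<beta>"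
  unfolding mean_suspicion_def
proof (rule sum_mono)
  fix \<omega>
  define b g where "b = pmf (\<pi> Bad) \<omega>" and "g = pmf (\<pi> Good) \<omega>"
  have bg: "b \<ge> 0" "g \<ge> 0" by (simp_all add: b_def g_def)
  show "pmf (\<pi> Bad) \<omega> * posterior \<pi> \<beta>' \<omega> Bad \<le> pmf (\<pi> Bad) \<omega> * posterior \<pi> \<beta> \<omega> Bad"
  proof (cases "b = 0")
    case False
    then have b: "b > 0" using bg by simp
    have pos: "(1 - \<beta>') * b + g > 0" "(1 - \<beta>) * b + g > 0"
      using assms b bg by (auto intro!: add_pos_nonneg mult_pos_pos)
    have "(1 - \<beta>') * b + g \<le> (1 - \<beta>) * b + g"
      using assms bg by (intro add_right_mono mult_right_mono) auto
    then have "g / ((1 - \<beta>) * b + g) \<le> g / ((1 - \<beta>') * b + g)"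
      using pos bg by (intro divide_left_mono mult_pos_pos)
    moreover have "x / (x + g) = 1 - g / (x + g)" if "x + g > 0" for x
      using that by (simp add: diff_divide_distrib[symmetric] eq_diff_eq add_divide_distrib[symmetric])
    ultimately have "(1 - \<beta>') * b / ((1 - \<beta>') * b + g) \<le> (1 - \<beta>) * b / ((1 - \<beta>) * b + g)"
      using pos by simp
    then show ?thesis
      unfolding posterior_Bad b_def[symmetric] g_def[symmetric]
      using bg by (intro mult_left_mono) auto
  qed (simp add: b_def)
qed

lemma continuous_on_mean_suspicion:
  assumes "\<And>\<beta>. \<beta> \<in> T \<Longrightarrow> \<beta> < 1"
  shows "continuous_on T (mean_suspicion \<pi>)"
  unfolding mean_suspicion_def posterior_Bad
proof (rule continuous_on_sum)
  fix \<omega>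
  define b g where "b = pmf (\<pi> Bad) \<omega>" and "g = pmf (\<pi> Good) \<omega>"
  have bg: "b \<ge> 0" "g \<ge> 0" by (simp_all add: b_def g_def)
  have "continuous_on T (\<lambda>\<beta>. b * ((1 - \<beta>) * b / ((1 - \<beta>) * b + g)))"
  proof (cases "b = 0")
    case False
    then have "(1 - \<beta>) * b + g > 0" if "\<beta> \<in> T" for \<beta>
      using assms[OF that] bg by (intro add_pos_nonneg mult_pos_pos) auto
    then show ?thesis
      by (intro continuous_intros) force
  qed simp
  then show "continuous_on T (\<lambda>\<beta>. pmf (\<pi> Bad) \<omega> *
      ((1 - \<beta>) * pmf (\<pi> Bad) \<omega> / ((1 - \<beta>) * pmf (\<pi> Bad) \<omega> + pmf (\<pi> Good) \<omega>)))"
    by (simp add: b_def g_def)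
qed

text \<open>Supports may vary with \<open>q\<close>, so a denominator can vanish at some
  \<open>q\<close>. There the term is squeezed between 0 and its weight, which tends to 0.\<close>

lemma continuous_on_mean_suspicion_signal:
  fixes \<pi> :: "'x::topological_space \<Rightarrow> 'w::finite info"
  assumes cont: "\<And>\<theta> \<omega>. continuous_on Q (\<lambda>q. pmf (\<pi> q \<theta>) \<omega>)" and \<beta>: "\<beta> < 1"
  shows "continuous_on Q (\<lambda>q. mean_suspicion (\<pi> q) \<beta>)"
  unfolding mean_suspicion_def
proof (rule continuous_on_sum)
  fix \<omega>
  define b g where "b = (\<lambda>q. pmf (\<pi> q Bad) \<omega>)" and "g = (\<lambda>q. pmf (\<pi> q Good) \<omega>)"
  have bg: "b q \<ge> 0" "g q \<ge> 0" for q by (simp_all add: b_def g_def)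
  have b_lim: "(b \<longlongrightarrow> b q) (at q within Q)" and g_lim: "(g \<longlongrightarrow> g q) (at q within Q)" if "q \<in> Q" for q
    using cont[of Bad \<omega>] cont[of Good \<omega>] that by (auto simp: b_def g_def continuous_on_def)
  show "continuous_on Q (\<lambda>q. pmf (\<pi> q Bad) \<omega> * posterior (\<pi> q) \<beta> \<omega> Bad)"
    unfolding continuous_on_def
  proof
    fix q assume q: "q \<in> Q"
    show "((\<lambda>q. pmf (\<pi> q Bad) \<omega> * posterior (\<pi> q) \<beta> \<omega> Bad) \<longlongrightarrow>
        pmf (\<pi> q Bad) \<omega> * posterior (\<pi> q) \<beta> \<omega> Bad) (at q within Q)"
    proof (cases "(1 - \<beta>) * b q + g q = 0")
      case False
      then show ?thesis
        unfolding posterior_Bad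
        using tendsto_mult[OF b_lim[OF q] tendsto_divide[OF tendsto_mult[OF tendsto_const b_lim[OF q]]
            tendsto_add[OF tendsto_mult[OF tendsto_const b_lim[OF q]] g_lim[OF q]]]]
        by (simp add: b_def g_def)
    next
      case True
      \<comment> \<open>The posterior jumps here, but its weight vanishes.\<close>
      have b0: "b q = 0"
        using True bg[of q] \<beta> by (simp add: add_nonneg_eq_0_iff)
      have "((\<lambda>q. pmf (\<pi> q Bad) \<omega> * posterior (\<pi> q) \<beta> \<omega> Bad) \<longlongrightarrow> 0) (at q within Q)"
      proof (rule tendsto_sandwich[OF _ _ tendsto_const])
        show "\<forall>\<^sub>F x in at q within Q. 0 \<le> pmf (\<pi> x Bad) \<omega> * posterior (\<pi> x) \<beta> \<omega> Bad"
          using posterior_Bad_bounds(1)[of \<beta>] \<beta> by (intro always_eventually allI mult_nonneg_nonneg) auto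
        show "\<forall>\<^sub>F x in at q within Q. pmf (\<pi> x Bad) \<omega> * posterior (\<pi> x) \<beta> \<omega> Bad \<le> b x"
          unfolding b_def
          using posterior_Bad_bounds(2)[of \<beta>] \<beta> by (intro always_eventually allI mult_left_le) auto
        show "(b \<longlongrightarrow> 0) (at q within Q)"
          using b_lim[OF q] b0 by simp
      qed
      then show ?thesis
        using b0 by (simp add: b_def)
    qed
  qed
qed

section \<open>Monotonicity in the Blackwell order\<close>

lemma pmf_bind_finite:
  fixes p :: "'v::finite pmf"
  shows "pmf (bind_pmf p K) \<omega> = (\<Sum>v\<in>UNIV. pmf p v * pmf (K v) \<omega>)"
  by (simp add: pmf_bind integral_measure_pmf_real[of UNIV] mult.commute)

text \<open>Up to the factor 1 - \<beta>, mean suspicion sums b^2/d with d = (1 - \<beta>) b + g.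
  Garbling acts linearly on the pairs (b, d), and b^2/d is convex and homogeneous of degree 1, so
  garbling can only lower the sum.\<close>

lemma mean_suspicion_blackwell_mono:
  fixes \<pi> :: "'w::finite info" and \<pi>' :: "'v::finite info"
  assumes "blackwell_dominates \<pi>' \<pi>" and \<beta>: "\<beta> < 1"
  shows "mean_suspicion \<pi> \<beta> \<le> mean_suspicion \<pi>' \<beta>"
proof -
  obtain K :: "'v \<Rightarrow> 'w pmf" where K: "\<And>\<theta>. \<pi> \<theta> = bind_pmf (\<pi>' \<theta>) K"
    using assms(1) unfolding blackwell_dominates_def by blast
  define t where "t = 1 - \<beta>"
  have t: "t > 0" using \<beta> by (simp add: t_def)
  define b d where "b = (\<lambda>\<omega>. pmf (\<pi> Bad) \<omega>)" and "d = (\<lambda>\<omega>. t * pmf (\<pi> Bad) \<omega> + pmf (\<pi> Good) \<omega>)"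
  define b' d' where "b' = (\<lambda>v. pmf (\<pi>' Bad) v)" and "d' = (\<lambda>v. t * pmf (\<pi>' Bad) v + pmf (\<pi>' Good) v)"
  have b_eq: "b \<omega> = (\<Sum>v\<in>UNIV. pmf (K v) \<omega> * b' v)" for \<omega>
    by (simp add: b_def b'_def K pmf_bind_finite mult.commute)
  have d_eq: "d \<omega> = (\<Sum>v\<in>UNIV. pmf (K v) \<omega> * d' v)" for \<omega>
    by (simp add: d_def d'_def K pmf_bind_finite sum_distrib_left sum.distrib[symmetric] algebra_simps)
  have d'_nonneg: "d' v \<ge> 0" for v
    using t by (simp add: d'_def)
  have d'_0: "b' v = 0" if "d' v = 0" for v
    using that t by (simp add: d'_def b'_def add_nonneg_eq_0_iff)
  \<comment> \<open>Tangent planes of the convex function \<open>b\<^sup>2/d\<close>.\<close>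
  have tangent: "2 * r * b' v - r\<^sup>2 * d' v \<le> (b' v)\<^sup>2 / d' v" for r v
  proof (cases "d' v = 0")
    case False
    then have "d' v > 0" using d'_nonneg[of v] by simp
    moreover have "0 \<le> (b' v - r * d' v)\<^sup>2" by simp
    ultimately show ?thesis
      by (simp add: field_simps power2_eq_square)
  qed (simp add: d'_0)
  have "(b \<omega>)\<^sup>2 / d \<omega> \<le> (\<Sum>v\<in>UNIV. pmf (K v) \<omega> * ((b' v)\<^sup>2 / d' v))" for \<omega>
  proof -
    \<comment> \<open>The slope whose tangent plane touches at (b, d); when d = 0 it is 0 and both
      sides of the next identity vanish.\<close>
    define r where "r = b \<omega> / d \<omega>"
    have "(b \<omega>)\<^sup>2 / d \<omega> = 2 * r * b \<omega> - r\<^sup>2 * d \<omega>"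
      by (simp add: r_def power2_eq_square)
    also have "\<dots> = (\<Sum>v\<in>UNIV. pmf (K v) \<omega> * (2 * r * b' v - r\<^sup>2 * d' v))"
      unfolding b_eq d_eq sum_distrib_left sum_subtractf[symmetric]
      by (simp add: algebra_simps)
    also have "\<dots> \<le> (\<Sum>v\<in>UNIV. pmf (K v) \<omega> * ((b' v)\<^sup>2 / d' v))"
      using tangent by (intro sum_mono mult_left_mono) auto
    finally show ?thesis .
  qed
  then have "(\<Sum>\<omega>\<in>UNIV. (b \<omega>)\<^sup>2 / d \<omega>) \<le> (\<Sum>\<omega>\<in>UNIV. \<Sum>v\<in>UNIV. pmf (K v) \<omega> * ((b' v)\<^sup>2 / d' v))"
    by (rule sum_mono)
  also have "\<dots> = (\<Sum>v\<in>UNIV. (b' v)\<^sup>2 / d' v)"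
    by (subst sum.swap)
      (simp add: sum_distrib_right[symmetric] sum_pmf_UNIV del: times_divide_eq_right)
  finally have le: "(\<Sum>\<omega>\<in>UNIV. (b \<omega>)\<^sup>2 / d \<omega>) \<le> (\<Sum>v\<in>UNIV. (b' v)\<^sup>2 / d' v)" .
  have "mean_suspicion \<pi> \<beta> = t * (\<Sum>\<omega>\<in>UNIV. (b \<omega>)\<^sup>2 / d \<omega>)"
    by (simp add: mean_suspicion_def posterior_Bad b_def d_def t_def power2_eq_square
        sum_distrib_left mult_ac)
  moreover have "mean_suspicion \<pi>' \<beta> = t * (\<Sum>v\<in>UNIV. (b' v)\<^sup>2 / d' v)"
    by (simp add: mean_suspicion_def posterior_Bad b'_def d'_def t_def power2_eq_square
        sum_distrib_left mult_ac)
  ultimately show ?thesis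
    using le t by simp
qed

lemma mean_suspicion_uninformative:
  assumes "uninformative \<pi>" "\<beta> < 1"
  shows "mean_suspicion \<pi> \<beta> = (1 - \<beta>) / (2 - \<beta>)"
proof -
  have "mean_suspicion \<pi> \<beta> = (\<Sum>\<omega>\<in>UNIV. pmf (\<pi> Bad) \<omega> * ((1 - \<beta>) / (2 - \<beta>)))"
    unfolding mean_suspicion_def
  proof (rule sum.cong)
    fix \<omega>
    define b where "b = pmf (\<pi> Bad) \<omega>"
    have "(1 - \<beta>) * b + b = (2 - \<beta>) * b" by (simp add: algebra_simps)
    then have "b * ((1 - \<beta>) * b / ((1 - \<beta>) * b + b)) = b * ((1 - \<beta>) / (2 - \<beta>))"
      by (cases "b = 0") simp_all
    then show "pmf (\<pi> Bad) \<omega> * posterior \<pi> \<beta> \<omega> Bad = pmf (\<pi> Bad) \<omega> * ((1 - \<beta>) / (2 - \<beta>))"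
      using assms(1) by (simp add: uninformative_def posterior_Bad b_def)
  qed simp
  then show ?thesis
    unfolding sum_distrib_right[symmetric] sum_pmf_UNIV by simp
qed

text \<open>A signal possible in the bad state rules out the good one, and \<beta> < 1 keeps report
  g possible in the bad state, so the posterior is 1.\<close>

lemma mean_suspicion_perfectly_informative:
  assumes "perfectly_informative \<pi>" "\<beta> < 1"
  shows "mean_suspicion \<pi> \<beta> = 1"
proof -
  have "pmf (\<pi> Bad) \<omega> * posterior \<pi> \<beta> \<omega> Bad = pmf (\<pi> Bad) \<omega>" for \<omega>
  proof (cases "pmf (\<pi> Bad) \<omega> = 0")
    case False
    then have "pmf (\<pi> Good) \<omega> = 0"
      using assms(1) by (auto simp: perfectly_informative_def set_pmf_iff disjoint_iff)
    then show ?thesis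
      using False assms(2) by (simp add: posterior_Bad)
  qed simp
  then show ?thesis
    unfolding mean_suspicion_def by (simp only: sum_pmf_UNIV)
qed


section \<open>The value of Regime J\<close>

text \<open>Keeps candidate efforts in the range where mean suspicion is antitone and
  continuous.\<close>

lemma effort_bounds:
  fixes L k A :: real
  assumes "k > L" "L > 0" "A \<in> {0..1}"
  shows "0 \<le> L / k / 2 * A" "L / k / 2 * A < 1 / 2" "L / k / 2 * A < 1"
proof -
  have l: "L / k < 1" "0 < L / k" using assms by auto
  then show "0 \<le> L / k / 2 * A" using assms(3) by (intro mult_nonneg_nonneg) auto
  have "L / k / 2 * A \<le> L / k / 2"
    using assms(3) l by (intro mult_left_le) auto
  also have "\<dots> < 1 / 2" using l(1) by (rule divide_strict_right_mono) simp
  finally show "L / k / 2 * A < 1 / 2" .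
  then show "L / k / 2 * A < 1" by linarith
qed

text \<open>An equilibrium leaves \<open>a\<close> free at signals of probability 0, but these carry
  no bad-state weight since effort is below 1. Hence only the mean level \<open>A\<close>
  matters.\<close>

lemma equilibrium_J_payoff:
  fixes \<pi> :: "'w::finite info"
  assumes par: "c > I" "I > 0" "k > L" "L > 0"
    and eq: "equilibrium_J c I k L X \<pi> \<beta> a"
  defines "A \<equiv> (\<Sum>\<omega>\<in>UNIV. pmf (\<pi> Bad) \<omega> * a \<omega>)"
  shows "A \<in> {0..1}" "A = I / c * mean_suspicion \<pi> (L / k / 2 * A)"
    "stake_payoff_J c I X \<pi> \<beta> a = (X - I) / 2 - I / 2 * ((1 - L / k / 2 * A) * (1 - A / 2))"
proof -
  note e = eq[unfolded equilibrium_J_iff[OF par], folded A_def]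
  have a: "0 \<le> a \<omega>" "a \<omega> \<le> 1" for \<omega>
    using e by (auto simp: less_imp_le)
  have "A \<le> (\<Sum>\<omega>\<in>UNIV. pmf (\<pi> Bad) \<omega> * 1)"
    unfolding A_def using a by (intro sum_mono mult_left_mono) auto
  moreover have "A \<ge> 0"
    unfolding A_def using a by (intro sum_nonneg) auto
  ultimately show A: "A \<in> {0..1}"
    by (simp add: sum_pmf_UNIV)
  have \<beta>: "\<beta> = L / k / 2 * A" using e by simp
  have \<beta>1: "\<beta> < 1" unfolding \<beta> by (rule effort_bounds(3)[OF par(3,4) A])
  have nonneg: "prob_g_signal \<pi> \<beta> \<omega> \<ge> 0" for \<omega>
    using \<beta>1 by (simp add: prob_g_signal_eq)
  have zero: "pmf (\<pi> Bad) \<omega> = 0" if "prob_g_signal \<pi> \<beta> \<omega> = 0" for \<omega>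
    using that \<beta>1 by (simp add: prob_g_signal_eq add_nonneg_eq_0_iff)
  have a_eq: "pmf (\<pi> Bad) \<omega> * a \<omega> = I / c * (pmf (\<pi> Bad) \<omega> * posterior \<pi> \<beta> \<omega> Bad)" for \<omega>
    using e nonneg[of \<omega>] zero[of \<omega>] by (cases "prob_g_signal \<pi> \<beta> \<omega> = 0") auto
  show "A = I / c * mean_suspicion \<pi> (L / k / 2 * A)"
    unfolding \<beta>[symmetric] mean_suspicion_def sum_distrib_left a_eq[symmetric] by (simp add: A_def)
  \<comment> \<open>Optimality makes Pr(g, s) times \<open>a\<close> equal to i times the joint
    bad-state mass, so the quadratic cost becomes linear in \<open>a\<close>.\<close>
  have cost: "c / 2 * (prob_g_signal \<pi> \<beta> \<omega> * (a \<omega>)\<^sup>2) = I / 4 * (1 - \<beta>) * (pmf (\<pi> Bad) \<omega> * a \<omega>)" for \<omega>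
  proof (cases "prob_g_signal \<pi> \<beta> \<omega> = 0")
    case False
    then have "a \<omega> = I / c * posterior \<pi> \<beta> \<omega> Bad" using e nonneg[of \<omega>] by auto
    then have "prob_g_signal \<pi> \<beta> \<omega> * a \<omega> = I / c * joint_g \<pi> \<beta> Bad \<omega>"
      using False by (simp add: posterior_def)
    then have "prob_g_signal \<pi> \<beta> \<omega> * a \<omega> * a \<omega> = I / c * joint_g \<pi> \<beta> Bad \<omega> * a \<omega>"
      by simp
    then show ?thesis
      using par by (simp add: power2_eq_square joint_g_def prob_g_def field_simps)
  qed (simp add: zero)
  have "c / 2 * (\<Sum>\<omega>\<in>UNIV. prob_g_signal \<pi> \<beta> \<omega> * (a \<omega>)\<^sup>2) = I / 4 * (1 - \<beta>) * A"
    unfolding sum_distrib_left cost A_def ..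
  moreover have "(\<Sum>\<omega>\<in>UNIV. pmf (\<pi> Bad) \<omega> * (1 - a \<omega>)) = 1 - A"
    by (simp add: A_def right_diff_distrib sum_subtractf sum_pmf_UNIV)
  ultimately have "stake_payoff_J c I X \<pi> \<beta> a = (X - I) / 2 - I / 2 * ((1 - \<beta>) * (1 - A / 2))"
    unfolding stake_payoff_J_eq by (simp only:) (simp add: field_simps)
  then show "stake_payoff_J c I X \<pi> \<beta> a = (X - I) / 2 - I / 2 * ((1 - L / k / 2 * A) * (1 - A / 2))"
    by (simp add: \<beta>)
qed

text \<open>The image of a level is antitone in that level. Testing one level thus locates the fixed
  point without tracking how it moves with the signal.\<close>

lemma mean_suspicion_fixpoint_iff:
  fixes \<pi> :: "'w::finite info"
  assumes par: "c > I" "I > 0" "k > L" "L > 0"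
    and A: "A \<in> {0..1}" "A = I / c * mean_suspicion \<pi> (L / k / 2 * A)" and B: "B \<in> {0..1}"
  shows "B < A \<longleftrightarrow> B < I / c * mean_suspicion \<pi> (L / k / 2 * B)"
proof -
  have anti: "I / c * mean_suspicion \<pi> (L / k / 2 * y) \<le> I / c * mean_suspicion \<pi> (L / k / 2 * x)"
    if "x \<le> y" "y \<in> {0..1}" for x y
    using that par by (intro mult_left_mono mean_suspicion_antimono effort_bounds(3)) auto
  show ?thesis
  proof
    assume "B < A"
    then show "B < I / c * mean_suspicion \<pi> (L / k / 2 * B)"
      using anti[of B A] A by simp
  next
    assume "B < I / c * mean_suspicion \<pi> (L / k / 2 * B)"
    then show "B < A"
      using anti[of A B] A B by (cases "B < A") auto
  qed
qed

text \<open>If one fixed point were below the other, it would lie strictly below its own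
  image.\<close>

lemma mean_suspicion_fixpoint_unique:
  fixes \<pi> :: "'w::finite info"
  assumes par: "c > I" "I > 0" "k > L" "L > 0"
    and A: "A \<in> {0..1}" "A = I / c * mean_suspicion \<pi> (L / k / 2 * A)"
    and B: "B \<in> {0..1}" "B = I / c * mean_suspicion \<pi> (L / k / 2 * B)"
  shows "A = B"
  using mean_suspicion_fixpoint_iff[OF par A B(1)] mean_suspicion_fixpoint_iff[OF par B A(1)] A(2) B(2)
  by linarith

lemma ex_mean_suspicion_fixpoint:
  fixes \<pi> :: "'w::finite info"
  assumes par: "c > I" "I > 0" "k > L" "L > 0"
  obtains A where "A \<in> {0..1}" "A = I / c * mean_suspicion \<pi> (L / k / 2 * A)"
proof -
  define h where "h = (\<lambda>A. A - I / c * mean_suspicion \<pi> (L / k / 2 * A))"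
  have cont: "continuous_on {0..1} h"
    unfolding h_def
  proof (intro continuous_intros continuous_on_compose2[OF continuous_on_mean_suspicion[of "{..<1}"]])
    show "(\<lambda>A. L / k / 2 * A) ` {0..1} \<subseteq> {..<1}"
      using effort_bounds(3)[OF par(3,4)] by (auto simp del: times_divide_eq_left)
  qed (use par in auto)
  have "h 0 \<le> 0"
    using mean_suspicion_bounds(1)[of 0 \<pi>] par by (simp add: h_def)
  moreover have "I / c * mean_suspicion \<pi> (L / k / 2) \<le> 1 * 1"
    using mean_suspicion_bounds[of "L / k / 2" \<pi>] effort_bounds(3)[OF par(3,4), of 1] par
    by (intro mult_mono) auto
  then have "0 \<le> h 1" by (simp add: h_def)
  ultimately obtain A where "0 \<le> A" "A \<le> 1" "h A = 0"
    using IVT'[of h 0 0 1] cont by auto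
  then show thesis
    using that[of A] by (simp add: h_def)
qed

text \<open>The value is well defined although the plan may differ at signals of probability 0: all
  equilibria share the same mean level.\<close>

lemma U_J_eq:
  fixes \<pi> :: "'w::finite info"
  assumes par: "c > I" "I > 0" "k > L" "L > 0"
    and A: "A \<in> {0..1}" "A = I / c * mean_suspicion \<pi> (L / k / 2 * A)"
  shows "U_J c I k L X \<pi> = (X - I) / 2 - I / 2 * ((1 - L / k / 2 * A) * (1 - A / 2))"
  unfolding U_J_def
proof (rule the_equality)
  define \<beta> where "\<beta> = L / k / 2 * A"
  \<comment> \<open>At signals of probability 0 this picks the admissible level 0.\<close>
  define a where "a = (\<lambda>\<omega>. I / c * posterior \<pi> \<beta> \<omega> Bad)"
  have \<beta>: "\<beta> \<le> 1"
    unfolding \<beta>_def using effort_bounds(3)[OF par(3,4) A(1)] by linarith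
  have sum_a: "(\<Sum>\<omega>\<in>UNIV. pmf (\<pi> Bad) \<omega> * a \<omega>) = A"
    using A(2) by (simp add: a_def \<beta>_def mean_suspicion_def sum_distrib_left mult_ac)
  have "a \<omega> \<in> {0..<1}" for \<omega>
  proof -
    have "a \<omega> \<le> I / c * 1"
      unfolding a_def using par posterior_Bad_bounds[OF \<beta>] by (intro mult_left_mono) auto
    moreover have "I / c < 1" using par by simp
    moreover have "0 \<le> a \<omega>"
      unfolding a_def using par posterior_Bad_bounds[OF \<beta>] by (intro mult_nonneg_nonneg) auto
    ultimately show ?thesis by simp
  qed
  then have "equilibrium_J c I k L X \<pi> \<beta> a"
    unfolding equilibrium_J_iff[OF par] sum_a by (auto simp: a_def \<beta>_def)
  moreover from equilibrium_J_payoff(3)[OF par this] have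
    "stake_payoff_J c I X \<pi> \<beta> a = (X - I) / 2 - I / 2 * ((1 - L / k / 2 * A) * (1 - A / 2))"
    unfolding sum_a .
  ultimately show "\<exists>\<beta> a. equilibrium_J c I k L X \<pi> \<beta> a \<and>
      (X - I) / 2 - I / 2 * ((1 - L / k / 2 * A) * (1 - A / 2)) = stake_payoff_J c I X \<pi> \<beta> a"
    by metis
next
  fix u assume "\<exists>\<beta> a. equilibrium_J c I k L X \<pi> \<beta> a \<and> u = stake_payoff_J c I X \<pi> \<beta> a"
  then obtain \<beta> a where e: "equilibrium_J c I k L X \<pi> \<beta> a" and u: "u = stake_payoff_J c I X \<pi> \<beta> a"
    by blast
  note p = equilibrium_J_payoff[OF par e]
  have "(\<Sum>\<omega>\<in>UNIV. pmf (\<pi> Bad) \<omega> * a \<omega>) = A"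
    by (rule mean_suspicion_fixpoint_unique[OF par p(1,2) A])
  with u p(3) show "u = (X - I) / 2 - I / 2 * ((1 - L / k / 2 * A) * (1 - A / 2))"
    by simp
qed


section \<open>The value of Regime C\<close>

text \<open>Since \<open>{0..<1}\<close> is not compact, the maximum is taken over
  \<open>{0..1}\<close> and level 1 is then excluded.\<close>

lemma U_C_maximum:
  fixes c I k L X :: real
  assumes par: "c > I" "I > 0" "k > L" "L > 0"
  defines "W \<equiv> (\<lambda>a. stake_payoff_C c I X (L / k / 2 * a) a)"
  obtains a where "a \<in> {0..<1}" "U_C c I k L X = W a" "\<And>x. x \<in> {0..<1} \<Longrightarrow> W x \<le> W a"
proof -
  define l i where "l = L / k" and "i = I / c"
  have l: "0 < l" "l < 1" and i: "0 < i" "i < 1" and I: "I = i * c" and c: "c > 0"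
    using par by (auto simp: l_def i_def)
  have "continuous_on {0..1} W"
    unfolding W_def stake_payoff_C_eq by (intro continuous_intros) auto
  then obtain a where a: "a \<in> {0..1}" and max: "\<And>x. x \<in> {0..1} \<Longrightarrow> W x \<le> W a"
    using continuous_attains_sup[of "{0..1::real}" W] by auto
  \<comment> \<open>The optimal level in the absence of deterrence beats full verification.\<close>
  have i2: "0 \<le> i\<^sup>2" "i\<^sup>2 \<le> 1"
    using i by (auto intro: power_le_one)
  have diff: "8 * (W i - W 1) = c * (1 - i) * (4 - l * (1 + i - i\<^sup>2))"
    unfolding W_def stake_payoff_C_eq l_def[symmetric] I by (simp add: field_simps power2_eq_square)
  have "l * (1 + i - i\<^sup>2) \<le> 1 * 2"
    using l i i2
    by (intro mult_mono; linarith)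
  then have "0 < c * (1 - i) * (4 - l * (1 + i - i\<^sup>2))"
    using c i by (intro mult_pos_pos) linarith+
  then have "W 1 < W i"
    unfolding diff[symmetric] by simp
  with max[of i] i have "a \<noteq> 1" by auto
  with a have a1: "a \<in> {0..<1}" by auto
  have W_max: "is_arg_max W (\<lambda>x. x \<in> {0..<1}) a"
    using a1 max unfolding is_arg_max_def by (fastforce simp: not_less)
  \<comment> \<open>The strategy is determined only on admissible commitments, which is enough to
    fix the equilibrium value.\<close>
  have best: "b x = L / k / 2 * x"
    if "\<forall>x\<in>{0..<1}. is_arg_max (auditor_payoff_C k L x) (\<lambda>\<beta>. \<beta> \<in> {0..1}) (b x)" "x \<in> {0..<1}" for b x
    using that auditor_best_response_C[OF par(3,4)] by blast
  have "U_C c I k L X = W a"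
    unfolding U_C_def
  proof (rule the_equality)
    have "equilibrium_C c I k L X a (\<lambda>x. L / k / 2 * x)"
      unfolding equilibrium_C_def using auditor_best_response_C[OF par(3,4)] W_max
      by (auto simp: W_def)
    then show "\<exists>a' b. equilibrium_C c I k L X a' b \<and> W a = stake_payoff_C c I X (b a') a'"
      by (auto simp: W_def)
  next
    fix u assume "\<exists>a' b. equilibrium_C c I k L X a' b \<and> u = stake_payoff_C c I X (b a') a'"
    then obtain a' b where e: "equilibrium_C c I k L X a' b"
      and u: "u = stake_payoff_C c I X (b a') a'" by blast
    have a': "a' \<in> {0..<1}"
      using e by (simp add: equilibrium_C_def is_arg_max_def)
    have val: "stake_payoff_C c I X (b x) x = W x" if "x \<in> {0..<1}" for x
      using e best[of b, OF _ that] by (simp add: equilibrium_C_def W_def)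
    have "\<not> stake_payoff_C c I X (b a) a > stake_payoff_C c I X (b a') a'"
      using e a1 by (auto simp: equilibrium_C_def is_arg_max_def)
    then show "u = W a"
      using val[OF a'] val[OF a1] max[of a'] a' u by auto
  qed
  then show thesis
    using that[OF a1] max by auto
qed


section \<open>Comparison of the two regimes\<close>

text \<open>The right side is the Regime J payoff at mean level I/c, the one a perfectly informative
  signal produces; it beats every admissible commitment.\<close>

lemma U_C_less_U_J_perfect:
  fixes c I k L X :: real
  assumes par: "c > I" "I > 0" "k > L" "L > 0"
  shows "U_C c I k L X < (X - I) / 2 - I / 2 * ((1 - L / k / 2 * (I / c)) * (1 - I / c / 2))"
proof -
  obtain a where a: "a \<in> {0..<1}" and U: "U_C c I k L X = stake_payoff_C c I X (L / k / 2 * a) a"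
    using U_C_maximum[OF par, where X = X] by metis
  define l i where "l = L / k" and "i = I / c"
  have l: "0 < l" "l < 1" and i: "0 < i" "i < 1" and I: "I = i * c" and c: "c > 0"
    using par by (auto simp: l_def i_def)
  define D where "D = (X - I) / 2 - I / 2 * ((1 - l / 2 * i) * (1 - i / 2)) - stake_payoff_C c I X (l / 2 * a) a"
  \<comment> \<open>The bracket is affine in \<open>l\<close>, with its values at l = 0 and l = 1
    arranged as sums of nonnegative terms; i^2 (1 - i) > 0 makes the second one positive.\<close>
  have "8 * D = c * ((1 - l) * (2 * (i - a)\<^sup>2 + 2 * a\<^sup>2) +
      l * (3 * (i - a)\<^sup>2 + i\<^sup>2 * (1 - i) + a\<^sup>2 * (1 - a) + 2 * a\<^sup>2 * i))"
    unfolding D_def stake_payoff_C_eq I by (simp add: field_simps power2_eq_square)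
  moreover have "(1 - l) * (2 * (i - a)\<^sup>2 + 2 * a\<^sup>2) \<ge> 0"
    using l by simp
  moreover have "3 * (i - a)\<^sup>2 + i\<^sup>2 * (1 - i) + a\<^sup>2 * (1 - a) + 2 * a\<^sup>2 * i > 0"
    using i a by (intro add_pos_nonneg add_nonneg_pos) auto
  ultimately have "8 * D > 0"
    using c l by (simp add: add_nonneg_pos)
  then have "D > 0" by simp
  then show ?thesis
    unfolding U D_def l_def i_def by linarith
qed

text \<open>An uninformative signal leaves the stakeholder with the payoff of committing to the level \<open>A\<close>,
  where only the deterrence effect of a marginal increase in verification survives.\<close>

lemma U_J_uninformative_less_U_C:
  fixes c I k L X A :: real
  assumes par: "c > I" "I > 0" "k > L" "L > 0" and A: "A \<in> {0..1}"
    and fp: "A = I / c * ((1 - L / k / 2 * A) / (2 - L / k / 2 * A))"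
  shows "(X - I) / 2 - I / 2 * ((1 - L / k / 2 * A) * (1 - A / 2)) < U_C c I k L X"
proof -
  define W where "W = (\<lambda>a. stake_payoff_C c I X (L / k / 2 * a) a)"
  have max: "W x \<le> U_C c I k L X" if "x \<in> {0..<1}" for x
    using U_C_maximum[OF par, where X = X] that unfolding W_def by metis
  define l i where "l = L / k" and "i = I / c"
  have l: "0 < l" "l < 1" and i: "0 < i" "i < 1" and I: "I = i * c" and c: "c > 0"
    using par by (auto simp: l_def i_def)
  have \<beta>: "0 \<le> l / 2 * A" "l / 2 * A < 1 / 2"
    unfolding l_def using effort_bounds[OF par(3,4) A] by blast+
  have "i * ((1 - l / 2 * A) / (2 - l / 2 * A)) \<le> i * 1"
    using \<beta> i by (intro mult_left_mono) (auto simp: divide_le_eq_1)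
  with fp have "A \<le> i"
    unfolding l_def i_def by linarith
  then have A1: "A < 1" using i by simp
  have "A = i * (1 - l / 2 * A) / (2 - l / 2 * A)"
    using fp unfolding l_def i_def times_divide_eq_right .
  moreover have "2 - l / 2 * A \<noteq> 0"
    using \<beta> by linarith
  \<comment> \<open>The first-order condition for the level when effort is held fixed at
    \<open>l / 2 * A\<close>.\<close>
  ultimately have foc: "A * (2 - l / 2 * A) = i * (1 - l / 2 * A)"
    by (rule iffD1[OF nonzero_eq_divide_eq, rotated])
  have foc_I: "(1 - l / 2 * A) * I = c * (A * (2 - l / 2 * A))"
    unfolding foc I by (simp only: mult_ac)
  have WA: "W A = (X - I) / 2 - I / 2 * ((1 - L / k / 2 * A) * (1 - A / 2))"
  proof -
    \<comment> \<open>The last summand carries the first-order condition and vanishes at effort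
      \<open>l / 2 * A\<close>.\<close>
    have "1 / 2 * (X - I) - 1 / 2 * (1 - b) * (1 - A) * I - (1 / 2 * (1 - b) + 1 / 2) * (c * A\<^sup>2 / 2) =
        (X - I) / 2 - I / 2 * ((1 - b) * (1 - A / 2)) + A / 4 * ((1 - b) * I - c * (A * (2 - b)))" for b
      by (simp add: field_simps power2_eq_square)
    with foc_I show ?thesis
      unfolding W_def stake_payoff_C_eq l_def[symmetric] by (simp only: diff_self mult_zero_right add_0_right)
  qed
  \<comment> \<open>The second and fourth terms are the direct effects and cancel by the first-order
    condition; the other two act through effort.\<close>
  have "(W has_real_derivative
      (l / 4 * (1 - A) * I + (1 - l / 2 * A) * I / 2 + l / 8 * (c * A\<^sup>2) - (2 - l / 2 * A) * c * A / 2)) (at A)"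
    unfolding W_def stake_payoff_C_eq l_def[symmetric]
    by (auto intro!: derivative_eq_intros simp: field_simps power2_eq_square)
  moreover have "(1 - l / 2 * A) * I / 2 = (2 - l / 2 * A) * c * A / 2"
    unfolding foc_I by (simp only: mult_ac)
  ultimately have "(W has_real_derivative (l / 4 * (1 - A) * I + l / 8 * (c * A\<^sup>2))) (at A)"
    by simp
  moreover have "0 < l / 4 * (1 - A) * I + l / 8 * (c * A\<^sup>2)"
    using l par A1 c by (intro add_pos_nonneg) auto
  ultimately obtain d where d: "d > 0" "\<And>h. 0 < h \<Longrightarrow> h < d \<Longrightarrow> W A < W (A + h)"
    using DERIV_pos_inc_right[of W _ A] by blast
  \<comment> \<open>Halving keeps \<open>A + h\<close> below 1, hence an admissible
    commitment.\<close>
  define h where "h = min d (1 - A) / 2"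
  have h: "0 < h" "h < d" "A + h < 1"
    using d(1) A1 by (auto simp: h_def min_def field_simps)
  then have "W A < U_C c I k L X"
    using d(2)[of h] max[of "A + h"] A by auto
  then show ?thesis
    unfolding WA .
qed

text \<open>Both factors of the loss are positive and strictly decreasing in the level.\<close>

lemma J_payoff_strict_mono:
  fixes l I x y :: real
  assumes "0 < l" "l < 1" "I > 0" "0 \<le> x" "x < y" "y \<le> 1"
  shows "m - I / 2 * ((1 - l / 2 * x) * (1 - x / 2)) < m - I / 2 * ((1 - l / 2 * y) * (1 - y / 2))"
proof -
  have "l * y \<le> 1 * 1" "l * x \<le> 1 * 1" using assms by (intro mult_mono; simp)+
  then have "(1 - l / 2 * y) * (1 - y / 2) < (1 - l / 2 * x) * (1 - x / 2)"
    using assms by (intro mult_strict_mono) auto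
  then show ?thesis using assms by simp
qed

text \<open>Under weak monotonicity the zeros may fill an interval; the threshold is the largest
  zero, which exists by compactness.\<close>

lemma monotone_sign_change:
  fixes h :: "real \<Rightarrow> real"
  assumes cont: "continuous_on {0..1} h"
    and mono: "\<And>x y. x \<in> {0..1} \<Longrightarrow> y \<in> {0..1} \<Longrightarrow> x < y \<Longrightarrow> h x \<le> h y"
    and "h 0 < 0" "0 < h 1"
  obtains z where "z \<in> {0<..<1}" "\<And>x. x \<in> {0..1} \<Longrightarrow> 0 < h x \<longleftrightarrow> z < x"
proof -
  define Z where "Z = {x\<in>{0..1}. h x = 0}"
  obtain x0 where x0: "x0 \<in> Z"
    using IVT'[of h 0 0 1] assms by (auto simp: Z_def)
  have "closed Z"
    unfolding Z_def using continuous_closed_preimage_constant[OF cont closed_atLeastAtMost] .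
  moreover have "bounded Z"
    by (rule bounded_subset[of "{0..1}"]) (auto simp: Z_def)
  ultimately obtain z where z: "z \<in> Z" "\<And>x. x \<in> Z \<Longrightarrow> x \<le> z"
    using compact_attains_sup[of Z] x0 by (auto simp: compact_eq_bounded_closed)
  have z01: "z \<in> {0..1}" and hz: "h z = 0" using z by (auto simp: Z_def)
  have "z \<in> {0<..<1}"
    using z01 hz assms(3,4) by (cases "z = 0"; cases "z = 1") auto
  moreover have "0 < h x \<longleftrightarrow> z < x" if x: "x \<in> {0..1}" for x
  proof
    assume "0 < h x"
    then show "z < x"
      using mono[OF x z01] hz by (cases x z rule: linorder_cases) auto
  next
    assume zx: "z < x"
    then have "h x \<noteq> 0" using z(2)[of x] x by (auto simp: Z_def)
    then show "0 < h x" using mono[OF z01 x zx] hz by simp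
  qed
  ultimately show thesis by (rule that)
qed

theorem proposition4:
  fixes c I k L X :: real
    and \<pi> :: "real \<Rightarrow> 'w::finite info"
  assumes "c > I" and "I > 0"
    and "k > L" and "L > 0"
    and "X / 2 > I"
    and "continuous_nested_family \<pi>"
  shows "\<exists>q\<^sub>0\<in>{0<..<1}. \<forall>q\<in>{0..1}.
           U_J c I k L X (\<pi> q) > U_C c I k L X \<longleftrightarrow> q > q\<^sub>0"
proof -
  note par = assms(1-4)
  define S where "S = (\<lambda>q A. I / c * mean_suspicion (\<pi> q) (L / k / 2 * A))"
  define \<Phi> where "\<Phi> = (\<lambda>A. (X - I) / 2 - I / 2 * ((1 - L / k / 2 * A) * (1 - A / 2)))"
  have cont: "\<And>\<theta> \<omega>. continuous_on {0..1} (\<lambda>q. pmf (\<pi> q \<theta>) \<omega>)"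
    and dom: "\<And>q q'. q \<in> {0..1} \<Longrightarrow> q' \<in> {0..1} \<Longrightarrow> q < q' \<Longrightarrow> blackwell_dominates (\<pi> q') (\<pi> q)"
    and ends: "uninformative (\<pi> 0)" "perfectly_informative (\<pi> 1)"
    using assms(6) by (auto simp: continuous_nested_family_def strictly_blackwell_dominates_def)
  have \<beta>1: "L / k / 2 * A < 1" if "A \<in> {0..1}" for A
    using effort_bounds(3)[OF par(3,4) that] .
  have l: "0 < L / k" "L / k < 1" and i: "I / c \<in> {0..1}"
    using par by auto
  have \<Phi>_mono: "\<Phi> x < \<Phi> y" if "0 \<le> x" "x < y" "y \<le> 1" for x y
    unfolding \<Phi>_def using J_payoff_strict_mono[OF l par(2) that] .
  have \<Phi>_less_iff: "\<Phi> x < \<Phi> y \<longleftrightarrow> x < y" if "x \<in> {0..1}" "y \<in> {0..1}" for x y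
    using \<Phi>_mono[of x y] \<Phi>_mono[of y x] that by (cases x y rule: linorder_cases) auto
  obtain A0 where A0: "A0 \<in> {0..1}" "A0 = S 0 A0"
    unfolding S_def using ex_mean_suspicion_fixpoint[OF par, of "\<pi> 0"] by blast
  have lo: "\<Phi> A0 < U_C c I k L X"
    unfolding \<Phi>_def using A0(2) mean_suspicion_uninformative[OF ends(1) \<beta>1[OF A0(1)]]
    by (intro U_J_uninformative_less_U_C[OF par A0(1)]) (simp only: S_def)
  have hi: "U_C c I k L X < \<Phi> (I / c)"
    unfolding \<Phi>_def by (rule U_C_less_U_J_perfect[OF par])
  have S1: "S 1 A = I / c" if "A \<in> {0..1}" for A
    unfolding S_def using mean_suspicion_perfectly_informative[OF ends(2) \<beta>1[OF that]] by simp
  have "A0 < I / c"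
    using lo hi \<Phi>_less_iff[OF A0(1) i] by simp
  moreover have "continuous_on {A0..I / c} \<Phi>"
    unfolding \<Phi>_def by (intro continuous_intros) simp
  \<comment> \<open>\<open>B\<close> is the mean level at which Regime J would exactly match Regime
    C.\<close>
  ultimately obtain B where B: "A0 \<le> B" "B \<le> I / c" "\<Phi> B = U_C c I k L X"
    using IVT'[of \<Phi> A0 "U_C c I k L X" "I / c"] lo hi by force
  have B01: "B \<in> {0..1}" using B A0(1) i by auto
  \<comment> \<open>The comparison becomes a sign condition in \<open>q\<close> with effort frozen
    at \<open>L / k / 2 * B\<close>.\<close>
  have prefers: "U_C c I k L X < U_J c I k L X (\<pi> q) \<longleftrightarrow> 0 < S q B - B" for q
  proof -
    obtain A where A: "A \<in> {0..1}" "A = I / c * mean_suspicion (\<pi> q) (L / k / 2 * A)"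
      using ex_mean_suspicion_fixpoint[OF par] by blast
    have "U_J c I k L X (\<pi> q) = \<Phi> A"
      unfolding \<Phi>_def by (rule U_J_eq[OF par A])
    then show ?thesis
      using \<Phi>_less_iff[OF B01 A(1)] mean_suspicion_fixpoint_iff[OF par A B01] B(3)
      by (simp add: S_def)
  qed
  have "A0 < B" "B < I / c"
    using lo hi B by (auto simp: order.strict_iff_order)
  have "S 0 B - B < 0"
  proof -
    have "S 0 B \<le> S 0 A0"
      unfolding S_def using \<open>A0 < B\<close> par \<beta>1[OF B01]
      by (intro mult_left_mono mean_suspicion_antimono) auto
    then show ?thesis using A0(2) \<open>A0 < B\<close> by simp
  qed
  moreover have "0 < S 1 B - B"
    using S1[OF B01] \<open>B < I / c\<close> by simp
  moreover have "continuous_on {0..1} (\<lambda>q. S q B - B)"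
    unfolding S_def
    by (intro continuous_intros continuous_on_mean_suspicion_signal cont \<beta>1[OF B01])
  moreover have "S x B - B \<le> S y B - B" if "x \<in> {0..1}" "y \<in> {0..1}" "x < y" for x y
    unfolding S_def using par mean_suspicion_blackwell_mono[OF dom[OF that] \<beta>1[OF B01]]
    by (intro diff_right_mono mult_left_mono) auto
  ultimately obtain q0 where "q0 \<in> {0<..<1}" "\<And>q. q \<in> {0..1} \<Longrightarrow> 0 < S q B - B \<longleftrightarrow> q0 < q"
    using monotone_sign_change[of "\<lambda>q. S q B - B"] by blast
  then show ?thesis
    using prefers by blast
qed

end
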